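(* Let $k$ be a fixed even positive integer. If $k\neq 6$ and $k$ is not a power of $2$ (i.e. $k\neq 2^i$ for every $i$), then the set $D(x^k)$ is a hyperoval in $PG(2,q)$ for at most a finite number of values of $q$ (where $q$ ranges over the powers of $2$).
   Context: For $q$ a power of $2$, $PG(2,q)$ is the Desarguesian projective plane whose points are homogeneous triples over $GF(q)$. A hyperoval in $PG(2,q)$ ($q$ even) is a set of $q+2$ points no three of which are collinear. For a polynomial $f$, $D(f(x))=\{(1,x,f(x)) : x\in GF(q)\}\cup\{(0,0,1),(0,1,0)\}\subset PG(2,q)$; in particular $D(x^k)$ is this set with $f(x)=x^k$. *)

theory Defs
  imports "HOL-Algebra.Algebraic_Closure_Type" "HOL-Library.Z2"
begin

text \<open>
  All fields \<open>GF(q)\<close>, \<open>q\<close> a power of 2, are realised inside one fixed algebraic closure of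
  \<open>GF(2)\<close>, so that \<open>q\<close> can be quantified over inside a formula. The lemmas below show that
  \<open>GF q\<close> is a subfield with \<open>q\<close> elements, and that it is the only one. For \<open>q\<close> not of the form
  \<open>2 ^ h\<close> with \<open>h > 0\<close>, the set \<open>GF q\<close> has no intended meaning.
\<close>

definition GF :: "nat \<Rightarrow> bit alg_closure set" where
  "GF q = {x. x ^ q = x}"

lemma CHAR_bit: "CHAR(bit) = 2"
proof (rule CHAR_eqI)
  show "of_nat 2 = (0 :: bit)"
    by simp
  show "2 dvd n" if "of_nat n = (0 :: bit)" for n
    using that by (cases "even n") (auto elim!: oddE)
qed

lemma GF_subfield:
  assumes "h > 0"
  shows "0 \<in> GF (2 ^ h)" "1 \<in> GF (2 ^ h)"
    "\<And>x y. x \<in> GF (2 ^ h) \<Longrightarrow> y \<in> GF (2 ^ h) \<Longrightarrow> x + y \<in> GF (2 ^ h)"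
    "\<And>x. x \<in> GF (2 ^ h) \<Longrightarrow> - x \<in> GF (2 ^ h)"
    "\<And>x y. x \<in> GF (2 ^ h) \<Longrightarrow> y \<in> GF (2 ^ h) \<Longrightarrow> x * y \<in> GF (2 ^ h)"
    "\<And>x. x \<in> GF (2 ^ h) \<Longrightarrow> inverse x \<in> GF (2 ^ h)"
proof -
  have 2: "(2 :: bit alg_closure) = 0"
    by (metis CHAR_alg_closure CHAR_bit of_nat_CHAR of_nat_numeral)
  have neg: "- x = x" for x :: "bit alg_closure"
    using 2 by (metis add_eq_0_iff mult_2 mult_zero_left)
  show "0 \<in> GF (2 ^ h)" "1 \<in> GF (2 ^ h)"
    by (auto simp: GF_def)
  show "x + y \<in> GF (2 ^ h)" if "x \<in> GF (2 ^ h)" "y \<in> GF (2 ^ h)" for x y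
    using that freshmans_dream'[where ?'a = "bit alg_closure" and x = x and y = y and n = h]
    by (auto simp: GF_def CHAR_bit)
  show "- x \<in> GF (2 ^ h)" if "x \<in> GF (2 ^ h)" for x
    using that by (simp add: neg)
  show "x * y \<in> GF (2 ^ h)" if "x \<in> GF (2 ^ h)" "y \<in> GF (2 ^ h)" for x y
    using that by (auto simp: GF_def power_mult_distrib)
  show "inverse x \<in> GF (2 ^ h)" if "x \<in> GF (2 ^ h)" for x
    using that by (auto simp: GF_def power_inverse)
qed

lemma card_GF:
  assumes "h > 0"
  shows "card (GF (2 ^ h)) = 2 ^ h"
proof -
  define q :: nat where "q = 2 ^ h"
  have q: "q > 1" "even q"
    using assms one_less_power[of "2::nat" h] by (auto simp: q_def)
  define p :: "bit alg_closure poly" where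
    "p = Polynomial.monom 1 q - Polynomial.monom 1 1"
  have deg: "Polynomial.degree p = q"
    unfolding p_def using q
    by (subst diff_conv_add_uminus, subst Polynomial.degree_add_eq_left)
       (auto simp: Polynomial.degree_monom_eq)
  hence "p \<noteq> 0"
    using q by auto
  obtain A where A: "size A = Polynomial.degree p"
    "p = Polynomial.smult (Polynomial.lead_coeff p) (\<Prod>x\<in>#A. [:-x, 1:])"
    using alg_closed_imp_factorization[OF \<open>p \<noteq> 0\<close>] by blast
  have roots: "set_mset A = GF q"
  proof -
    have "poly p x = 0 \<longleftrightarrow> x \<in># A" for x
      using \<open>p \<noteq> 0\<close> by (subst A(2)) (auto simp: poly_prod_mset prod_mset_zero_iff)
    thus ?thesis
      by (auto simp: p_def GF_def poly_monom)
  qed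
  have qz: "of_nat q = (0 :: bit alg_closure)"
    using q(2) by (simp add: of_nat_eq_0_iff_char_dvd CHAR_bit)
  have pd: "pderiv p = - 1"
    unfolding p_def pderiv_diff pderiv_monom using qz
    by (simp add: one_pCons monom_0)
  have "count A a \<le> 1" for a
  proof (rule ccontr)
    assume "\<not> count A a \<le> 1"
    hence "{#a, a#} \<subseteq># A"
      by (auto simp: subseteq_mset_def)
    then obtain B where "A = {#a, a#} + B"
      using subset_mset.le_iff_add by blast
    hence "\<exists>r. p = [:-a, 1:] * ([:-a, 1:] * r)"
      using A(2) by (metis (no_types, lifting) image_mset_add_mset mult_smult_right
        prod_mset.add_mset union_mset_add_mset_left empty_neutral(1))
    then obtain r where "p = [:-a, 1:] * ([:-a, 1:] * r)" ..
    hence "poly (pderiv p) a = 0"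
      by (simp only: pderiv_mult poly_add poly_mult) simp
    thus False
      by (simp add: pd)
  qed
  hence "mset_set (set_mset A) = A"
    by (intro multiset_eqI)
       (metis count_mset_set(1) count_mset_set(3) finite_set_mset le_antisym
          count_greater_eq_one_iff not_in_iff)
  hence "card (set_mset A) = size A"
    by (metis size_mset_set)
  thus ?thesis
    using A(1) deg roots by (simp add: q_def)
qed

lemma GF_unique:
  assumes "h > 0" "card K = 2 ^ h" "0 \<in> K" "1 \<in> K"
    and mult: "\<And>x y. x \<in> K \<Longrightarrow> y \<in> K \<Longrightarrow> x * y \<in> K"
  shows "K = GF (2 ^ h)"
proof -
  have fin: "finite K" "finite (GF (2 ^ h))"
    using assms(2) card_GF[OF assms(1)] by (auto intro: card_ge_0_finite)
  have "a \<in> GF (2 ^ h)" if a: "a \<in> K" for a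
  proof (cases "a = 0")
    case False
    have "(\<lambda>x. a * x) ` (K - {0}) = K - {0}"
      using fin a mult False by (intro endo_inj_surj) (auto simp: inj_on_def)
    hence "(\<Prod>x\<in>K - {0}. x) = (\<Prod>x\<in>(\<lambda>x. a * x) ` (K - {0}). x)"
      by simp
    also have "\<dots> = (\<Prod>x\<in>K - {0}. a * x)"
      using False by (subst prod.reindex) (auto simp: inj_on_def)
    also have "\<dots> = a ^ (2 ^ h - 1) * (\<Prod>x\<in>K - {0}. x)"
      using assms(2,3) fin by (simp add: prod.distrib)
    finally have "a ^ (2 ^ h - 1) = 1"
      using fin by (auto simp: prod_zero_iff)
    hence "a * a ^ (2 ^ h - 1) = a"
      by simp
    thus ?thesis
      by (simp add: GF_def flip: power_Suc)
  qed (use assms in \<open>auto simp: GF_def\<close>)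
  thus ?thesis
    using fin assms(2) card_GF[OF assms(1)] by (intro card_subset_eq) auto
qed

text \<open>
  The projective plane over a subfield \<open>K\<close>: a point is the class of all nonzero \<open>K\<close>-multiples
  of a nonzero triple over \<open>K\<close>.
\<close>

definition nonzero_triples :: "'a::field set \<Rightarrow> ('a \<times> 'a \<times> 'a) set" where
  "nonzero_triples K = K \<times> K \<times> K - {(0, 0, 0)}"

definition proj_point :: "'a::field set \<Rightarrow> 'a \<times> 'a \<times> 'a \<Rightarrow> ('a \<times> 'a \<times> 'a) set" where
  "proj_point K = (\<lambda>(x, y, z). {(c * x, c * y, c * z) | c. c \<in> K - {0}})"

definition pg_points :: "'a::field set \<Rightarrow> ('a \<times> 'a \<times> 'a) set set" where
  "pg_points K = proj_point K ` nonzero_triples K"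

definition proj_line :: "'a::field set \<Rightarrow> 'a \<times> 'a \<times> 'a \<Rightarrow> ('a \<times> 'a \<times> 'a) set set" where
  "proj_line K = (\<lambda>(a, b, c).
     {proj_point K (x, y, z) | x y z.
        (x, y, z) \<in> nonzero_triples K \<and> a * x + b * y + c * z = 0})"

definition pg_lines :: "'a::field set \<Rightarrow> ('a \<times> 'a \<times> 'a) set set set" where
  "pg_lines K = proj_line K ` nonzero_triples K"

definition collinear_points :: "'a::field set \<Rightarrow> ('a \<times> 'a \<times> 'a) set set \<Rightarrow> bool" where
  "collinear_points K S \<longleftrightarrow> (\<exists>L\<in>pg_lines K. S \<subseteq> L)"

definition hyperoval :: "'a::field set \<Rightarrow> ('a \<times> 'a \<times> 'a) set set \<Rightarrow> bool" where
  "hyperoval K H \<longleftrightarrow>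
     even (card K) \<and> H \<subseteq> pg_points K \<and> card H = card K + 2 \<and>
     (\<forall>P\<in>H. \<forall>Q\<in>H. \<forall>R\<in>H. P \<noteq> Q \<and> P \<noteq> R \<and> Q \<noteq> R \<longrightarrow> \<not> collinear_points K {P, Q, R})"

text \<open>In \<open>D K f\<close> the coefficients of \<open>f\<close> are meant to lie in \<open>K\<close>.\<close>

definition D :: "'a::field set \<Rightarrow> 'a poly \<Rightarrow> ('a \<times> 'a \<times> 'a) set set" where
  "D K f = {proj_point K (1, x, poly f x) | x. x \<in> K} \<union>
     {proj_point K (0, 0, 1), proj_point K (0, 1, 0)}"

end

theory Submission
  imports Defs
begin

text \<open>If \<open>D(x\<^sup>k)\<close> is a hyperoval, the slopes \<open>((x + 1)\<^sup>k + 1) / x\<close> of the secants through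
  \<open>(1, 1, 1)\<close> permute the nonzero elements of the field, so their \<open>d\<close>-th powers sum to 0 for
  \<open>0 < d < q - 1\<close>. Expanding yields Glynn's criterion: for no such \<open>d\<close> are the binary digits
  of \<open>d\<close> contained in those of \<open>k d mod (q - 1)\<close>. Write \<open>k = 2 n\<close> and \<open>q = 2\<^sup>h\<close>. A violating \<open>d\<close>
  is the same as a nontrivial closed walk of length \<open>h\<close> in the finite graph of carries of the
  multiplication by \<open>k\<close>, with edges from \<open>c\<close> to \<open>c div 2\<close> and, for odd \<open>c\<close>, also to
  \<open>c div 2 + n\<close>. Unless \<open>n = 3\<close> or \<open>n\<close> is a power of 2, the lengths of the closed walks at the
  vertex 1 have no common divisor other than 1, so all sufficiently large \<open>h\<close> occur.\<close>

section \<open>Binary digits of binomial coefficients and of products\<close>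

text \<open>One digit of Lucas' theorem modulo 2. Pascal's rule applied twice cancels the middle
  term, so the induction descends by 2.\<close>

lemma odd_choose_iff:
  "odd (n choose m) \<longleftrightarrow> odd (n div 2 choose (m div 2)) \<and> (odd m \<longrightarrow> odd n)"
proof (induction n arbitrary: m rule: induct_nat_012)
  case 0
  then show ?case by (cases m; cases "m - 1") auto
next
  case 1
  then show ?case by (cases m; cases "m - 1") auto
next
  case (ge2 n)
  consider "m = 0" | "m = 1" | l where "m = Suc (Suc l)"
    by (metis One_nat_def not0_implies_Suc)
  then show ?case
  proof cases
    case 3
    have "odd (Suc (Suc n) choose m) \<longleftrightarrow> odd (n choose l) \<noteq> odd (n choose (Suc (Suc l)))"
      using 3 by auto
    then show ?thesis
      unfolding ge2.IH(1) using 3 by auto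
  qed auto
qed

text \<open>The carries in the schoolbook multiplication of \<open>d\<close> by \<open>2 * n\<close>, least significant
  digit first, where a digit 1 of \<open>d\<close> is only allowed if the product has a digit 1 there too.\<close>

definition carry_step :: "nat \<Rightarrow> (nat \<times> nat) set" where
  "carry_step n = {(c, c'). c' = c div 2 \<or> odd c \<and> c' = c div 2 + n}"

text \<open>Each edge supplies one digit of \<open>d\<close> and one of \<open>e\<close>, lowest
  first. The digit of \<open>d\<close> never exceeds that of \<open>e\<close>, so Lucas' theorem
  makes the binomial coefficient odd.\<close>

lemma carry_walk_digits:
  assumes "(c, c') \<in> carry_step n ^^ h"
  shows "\<exists>d e. d < 2 ^ h \<and> e < 2 ^ h \<and> odd (e choose d) \<and> c + 2 * n * d = 2 ^ h * c' + e"
  using assms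
proof (induction h arbitrary: c)
  case 0
  then show ?case by (intro exI[of _ 0]) auto
next
  case (Suc h)
  then obtain x where x: "(c, x) \<in> carry_step n" "(x, c') \<in> carry_step n ^^ h"
    by (meson relpow_Suc_D2)
  from Suc.IH[OF x(2)] obtain d e where de: "d < 2 ^ h" "e < 2 ^ h" "odd (e choose d)"
    "x + 2 * n * d = 2 ^ h * c' + e" by blast
  \<comment> \<open>The new lowest digit of the multiplier: 1 iff the edge is not plain
    halving.\<close>
  define b where "b = of_bool (x \<noteq> c div 2) * (1 :: nat)"
  have b: "c + 2 * n * b = 2 * x + c mod 2" "b \<le> c mod 2"
    using x(1) by (auto simp: b_def carry_step_def algebra_simps odd_iff_mod_2_eq_one)
  have "c + 2 * n * (2 * d + b) = 2 * (x + 2 * n * d) + c mod 2"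
    using b(1) by (simp add: algebra_simps)
  also have "\<dots> = 2 ^ Suc h * c' + (2 * e + c mod 2)"
    unfolding de(4) by simp
  finally have 1: "c + 2 * n * (2 * d + b) = 2 ^ Suc h * c' + (2 * e + c mod 2)" .
  have b2: "b = 0 \<or> b = 1 \<and> c mod 2 = 1"
    using b(2) by linarith
  then have "odd ((2 * e + c mod 2) choose (2 * d + b))"
    using de(3) by (subst odd_choose_iff) auto
  moreover have "2 * d + b < 2 ^ Suc h" "2 * e + c mod 2 < 2 ^ Suc h"
    using de(1,2) b2 by auto
  ultimately show ?case using 1 by blast
qed

section \<open>Power sums over finite fields of characteristic 2\<close>

lemma char2: "(2 :: bit alg_closure) = 0"
  by (metis CHAR_alg_closure CHAR_bit of_nat_CHAR of_nat_numeral)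

lemma char2_add_self: "x + x = (0 :: bit alg_closure)"
  using char2 by (metis mult_2 mult_zero_left)

lemma of_nat_char2: "(of_nat m :: bit alg_closure) = of_bool (odd m)"
  by (auto simp: char2 elim!: evenE oddE)

lemma finite_GF: "h > 0 \<Longrightarrow> finite (GF (2 ^ h))"
  using card_GF[of h] by (intro card_ge_0_finite) simp

lemma GF_power_closed: "h > 0 \<Longrightarrow> x \<in> GF (2 ^ h) \<Longrightarrow> x ^ m \<in> GF (2 ^ h)"
  by (induction m) (auto intro: GF_subfield)

lemma GF_power_card_minus_one:
  assumes "x \<in> GF (2 ^ h)" "x \<noteq> 0"
  shows "x ^ (2 ^ h - 1) = 1"
proof -
  have "x * x ^ (2 ^ h - 1) = x"
    using assms by (simp add: GF_def flip: power_Suc)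
  then show ?thesis using assms by simp
qed

text \<open>If \<open>a ^ m \<noteq> 1\<close> for some nonzero \<open>a\<close>, multiplication by
  \<open>a\<close> permutes the summands and scales the sum by \<open>a ^ m\<close>, so it vanishes.
  Otherwise an odd number of summands equal 1.\<close>

lemma sum_power_GF:
  assumes h: "h > 0"
  shows "(\<Sum>x\<in>GF (2 ^ h) - {0}. x ^ m) = of_bool ((2 ^ h - 1) dvd m)"
proof (cases "(2 ^ h - 1) dvd m")
  case True
  then have "x ^ m = 1" if "x \<in> GF (2 ^ h) - {0}" for x
    using that GF_power_card_minus_one[of x h] by (auto simp: power_mult elim!: dvdE)
  then have "(\<Sum>x\<in>GF (2 ^ h) - {0}. x ^ m) = of_nat (2 ^ h - 1)"
    using h by (simp add: card_GF finite_GF GF_subfield)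
  with True h show ?thesis by (subst (asm) of_nat_char2) simp
next
  case False
  define r where "r = m mod (2 ^ h - 1)"
  have r: "r > 0" using False by (simp only: r_def mod_greater_zero_iff_not_dvd not_False_eq_True)
  have "2 ^ h - 1 > (0::nat)" using one_less_power[of "2::nat" h] h by simp
  then have rq: "r < 2 ^ h - 1" unfolding r_def by (rule mod_less_divisor)
  have pow: "x ^ m = x ^ r" if "x \<in> GF (2 ^ h) - {0}" for x
  proof -
    have "x ^ m = x ^ ((2 ^ h - 1) * (m div (2 ^ h - 1)) + r)" by (simp add: r_def)
    also have "\<dots> = x ^ r"
      using that GF_power_card_minus_one[of x h] by (simp only: power_add power_mult) auto
    finally show ?thesis .
  qed
  \<comment> \<open>\<open>P\<close> is nonzero with at most \<open>r < 2 ^ h - 1\<close> roots, so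
    some nonzero \<open>a\<close> is not a root.\<close>
  define P :: "bit alg_closure poly" where "P = Polynomial.monom 1 r - 1"
  have "coeff P r = 1" using r by (simp add: P_def)
  then have P0: "P \<noteq> 0" by auto
  have degP: "Polynomial.degree P \<le> r"
    unfolding P_def by (intro Polynomial.degree_diff_le) (auto simp: Polynomial.degree_monom_eq)
  have "\<exists>a\<in>GF (2 ^ h) - {0}. a ^ r \<noteq> 1"
  proof (rule ccontr)
    assume "\<not> ?thesis"
    then have "GF (2 ^ h) - {0} \<subseteq> {x. poly P x = 0}"
      by (auto simp: P_def poly_monom)
    then have "card (GF (2 ^ h) - {0}) \<le> Polynomial.degree P"
      using card_poly_roots_bound[OF P0] card_mono[OF poly_roots_finite[OF P0]] le_trans by blast
    then show False
      using degP rq h by (simp add: card_GF finite_GF GF_subfield)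
  qed
  then obtain a where a: "a \<in> GF (2 ^ h)" "a \<noteq> 0" "a ^ r \<noteq> 1" by auto
  let ?S = "\<Sum>x\<in>GF (2 ^ h) - {0}. x ^ m"
  have "(\<lambda>x. a * x) ` (GF (2 ^ h) - {0}) = GF (2 ^ h) - {0}"
    using finite_GF[OF h] a GF_subfield(5)[OF h] by (intro endo_inj_surj) (auto simp: inj_on_def)
  then have "?S = (\<Sum>x\<in>(\<lambda>x. a * x) ` (GF (2 ^ h) - {0}). x ^ m)" by simp
  also have "\<dots> = (\<Sum>x\<in>GF (2 ^ h) - {0}. (a * x) ^ m)"
    using a by (subst sum.reindex) (auto simp: inj_on_def)
  also have "\<dots> = a ^ r * ?S"
    using a pow by (simp add: power_mult_distrib sum_distrib_left)
  finally have "?S = 0" using a(3) by simp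
  with False show ?thesis by simp
qed

text \<open>The power sum extracts a coefficient: the exponents \<open>j + (2 ^ h - 1 - d)\<close>
  lie strictly between 0 and \<open>2 * (2 ^ h - 1)\<close>, so only \<open>j = d\<close>
  survives.\<close>

lemma sum_GF_binomial:
  assumes h: "h > 0" and d: "0 < d" "d < 2 ^ h - 1" and e: "e \<le> 2 ^ h - 1"
  shows "(\<Sum>x\<in>GF (2 ^ h) - {0}. (x + 1) ^ e * x ^ (2 ^ h - 1 - d)) = of_nat (e choose d)"
proof -
  let ?q = "2 ^ h - 1 :: nat"
  have "(\<Sum>x\<in>GF (2 ^ h) - {0}. (x + 1) ^ e * x ^ (?q - d))
      = (\<Sum>x\<in>GF (2 ^ h) - {0}. \<Sum>j\<le>e. of_nat (e choose j) * x ^ (j + (?q - d)))"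
    by (simp add: binomial_ring sum_distrib_right power_add mult.assoc)
  also have "\<dots> = (\<Sum>j\<le>e. of_nat (e choose j) * (\<Sum>x\<in>GF (2 ^ h) - {0}. x ^ (j + (?q - d))))"
    by (subst sum.swap) (simp add: sum_distrib_left)
  also have "\<dots> = (\<Sum>j\<le>e. of_nat (e choose j) * of_bool (j = d))"
  proof (intro sum.cong refl)
    fix j assume j: "j \<in> {..e}"
    have "?q dvd j + (?q - d) \<longleftrightarrow> j = d"
    proof
      assume "?q dvd j + (?q - d)"
      then obtain m where m: "j + (?q - d) = ?q * m" by blast
      have "j + (?q - d) < ?q * 2" "0 < j + (?q - d)" using j e d by auto
      then have "m = 1" unfolding m by (cases m; cases "m - 1") auto
      with m d show "j = d" by simp
    qed (use d in auto)
    then show "of_nat (e choose j) * (\<Sum>x\<in>GF (2 ^ h) - {0}. x ^ (j + (?q - d)))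
      = of_nat (e choose j) * of_bool (j = d)"
      by (simp only: sum_power_GF[OF h])
  qed
  also have "\<dots> = of_nat (e choose d)"
    by (cases "d \<le> e") (simp_all add: of_bool_def if_distrib binomial_eq_0 cong: if_cong)
  finally show ?thesis .
qed

section \<open>Slopes of the secants of a hyperoval\<close>

lemma proj_point_1_neq_1:
  assumes "1 \<in> K" "x \<noteq> x'"
  shows "proj_point K (1, x, y) \<noteq> proj_point K (1, x', y')"
proof
  assume *: "proj_point K (1, x, y) = proj_point K (1, x', y')"
  have "(1, x, y) \<in> proj_point K (1, x, y)" using assms(1) by (force simp: proj_point_def)
  then have "(1, x, y) \<in> proj_point K (1, x', y')" using * by simp
  then show False using assms(2) by (auto simp: proj_point_def)
qed

lemma proj_point_1_neq_0:
  assumes "1 \<in> K"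
  shows "proj_point K (1, x, y) \<noteq> proj_point K (0, x', y')"
proof
  assume *: "proj_point K (1, x, y) = proj_point K (0, x', y')"
  have "(1, x, y) \<in> proj_point K (1, x, y)" using assms(1) by (force simp: proj_point_def)
  then have "(1, x, y) \<in> proj_point K (0, x', y')" using * by simp
  then show False by (auto simp: proj_point_def)
qed

lemma collinear_pointsI:
  assumes "(a, b, c) \<in> nonzero_triples K"
    and "\<And>x y z. (x, y, z) \<in> S \<Longrightarrow> (x, y, z) \<in> nonzero_triples K \<and> a * x + b * y + c * z = 0"
  shows "collinear_points K (proj_point K ` S)"
  unfolding collinear_points_def
proof
  show "proj_line K (a, b, c) \<in> pg_lines K" using assms(1) by (simp add: pg_lines_def)
  show "proj_point K ` S \<subseteq> proj_line K (a, b, c)"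
    using assms(2) by (fastforce simp: proj_line_def)
qed

lemma hyperoval_not_collinear:
  assumes "hyperoval K H" "proj_point K ` {u, v, w} \<subseteq> H"
    "proj_point K u \<noteq> proj_point K v" "proj_point K u \<noteq> proj_point K w"
    "proj_point K v \<noteq> proj_point K w"
  shows "\<not> collinear_points K (proj_point K ` {u, v, w})"
  using assms by (auto simp: hyperoval_def)

lemma proj_point_graph_in_D:
  "x \<in> K \<Longrightarrow> proj_point K (1, x, x ^ k) \<in> D K (Polynomial.monom 1 k)"
  unfolding D_def by (auto simp: poly_monom)

text \<open>Slope 0 would put two graph points and \<open>(0, 1, 0)\<close> on the line
  \<open>X + Z = 0\<close>.\<close>

lemma hyperoval_slope_neq_0:
  assumes h: "h > 0" and hyp: "hyperoval (GF (2 ^ h)) (D (GF (2 ^ h)) (Polynomial.monom 1 k))"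
    and x: "x \<in> GF (2 ^ h)" "x \<noteq> 0"
  shows "((x + 1) ^ k + 1) / x \<noteq> 0"
proof
  let ?K = "GF (2 ^ h)"
  let ?p = "proj_point ?K"
  let ?u = "(1, 1, 1 ^ k)" and ?v = "(1, x + 1, (x + 1) ^ k)"
    and ?w = "(0, 1, 0) :: bit alg_closure \<times> bit alg_closure \<times> bit alg_closure"
  assume "((x + 1) ^ k + 1) / x = 0"
  then have "(x + 1) ^ k + 1 = 0" using x(2) by simp
  then have xk: "(x + 1) ^ k = 1" by (metis add_right_cancel char2_add_self)
  have 0: "0 \<in> ?K" and 1: "1 \<in> ?K" and x1: "x + 1 \<in> ?K"
    using GF_subfield(1-3)[OF h] x(1) by blast+
  have nz: "?u \<in> nonzero_triples ?K" "?v \<in> nonzero_triples ?K" "?w \<in> nonzero_triples ?K"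
    "(1, 0, 1) \<in> nonzero_triples ?K"
    using 0 1 x1 by (simp_all add: nonzero_triples_def xk)
  have "collinear_points ?K (?p ` {?u, ?v, ?w})"
    by (rule collinear_pointsI[OF nz(4)]) (use nz(1-3) in \<open>auto simp: xk char2_add_self\<close>)
  moreover have "?p ?u \<in> D ?K (Polynomial.monom 1 k)" "?p ?v \<in> D ?K (Polynomial.monom 1 k)"
    using 1 x1 by (blast intro: proj_point_graph_in_D)+
  moreover have "?p ?w \<in> D ?K (Polynomial.monom 1 k)" by (simp add: D_def)
  moreover have "?p ?u \<noteq> ?p ?v" using x(2) by (intro proj_point_1_neq_1[OF 1]) simp
  ultimately show False
    using hyperoval_not_collinear[OF hyp, of ?u ?v ?w] proj_point_1_neq_0[OF 1] by simp
qed

text \<open>A common slope \<open>g\<close> would put three graph points on the line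
  \<open>(1 + g) X + g Y + Z = 0\<close>.\<close>

lemma hyperoval_slope_inj:
  assumes h: "h > 0" and hyp: "hyperoval (GF (2 ^ h)) (D (GF (2 ^ h)) (Polynomial.monom 1 k))"
    and x: "x \<in> GF (2 ^ h)" "x \<noteq> 0" and y: "y \<in> GF (2 ^ h)" "y \<noteq> 0"
    and eq: "((x + 1) ^ k + 1) / x = ((y + 1) ^ k + 1) / y"
  shows "x = y"
proof (rule ccontr)
  assume "x \<noteq> y"
  let ?K = "GF (2 ^ h)"
  let ?p = "proj_point ?K"
  let ?u = "(1, 1, 1 ^ k)" and ?v = "(1, x + 1, (x + 1) ^ k)" and ?w = "(1, y + 1, (y + 1) ^ k)"
  define g where "g = ((x + 1) ^ k + 1) / x"
  have 1: "1 \<in> ?K" and x1: "x + 1 \<in> ?K" and y1: "y + 1 \<in> ?K"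
    using GF_subfield(2,3)[OF h] x(1) y(1) by blast+
  have "g \<in> ?K"
    unfolding g_def divide_inverse using x(1) x1 1
    by (intro GF_subfield(3,5,6)[OF h] GF_power_closed[OF h])
  then have nz: "?u \<in> nonzero_triples ?K" "?v \<in> nonzero_triples ?K" "?w \<in> nonzero_triples ?K"
    "(1 + g, g, 1) \<in> nonzero_triples ?K"
    using 1 x1 y1 GF_subfield(3)[OF h 1] GF_power_closed[OF h]
    by (simp_all add: nonzero_triples_def)
  have line: "(1 + g) * 1 + g * (z + 1) + 1 * (z + 1) ^ k = 0"
    if "z \<noteq> 0" "g = ((z + 1) ^ k + 1) / z" for z
  proof -
    have zk: "(z + 1) ^ k = g * z + 1"
      using that by (simp add: add.assoc char2_add_self)
    have "(1 + g) * 1 + g * (z + 1) + 1 * (z + 1) ^ k = (1 + 1) + (g + g) + (g * z + g * z)"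
      unfolding zk by (simp only: distrib_left mult_1_left mult_1_right ac_simps)
    then show ?thesis by (simp only: char2_add_self add_0)
  qed
  have "(1 + g) * 1 + g * 1 + 1 * 1 ^ k = 0"
    using char2_add_self[of "1 + g"] by (simp add: ac_simps)
  then have "collinear_points ?K (?p ` {?u, ?v, ?w})"
    using nz(1-3) line[OF x(2)] line[OF y(2)] eq
    by (intro collinear_pointsI[OF nz(4)]) (auto simp: g_def)
  moreover have "?p ?u \<in> D ?K (Polynomial.monom 1 k)" "?p ?v \<in> D ?K (Polynomial.monom 1 k)"
    "?p ?w \<in> D ?K (Polynomial.monom 1 k)"
    using 1 x1 y1 by (blast intro: proj_point_graph_in_D)+
  moreover have "?p ?u \<noteq> ?p ?v" "?p ?u \<noteq> ?p ?w" "?p ?v \<noteq> ?p ?w"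
    using x(2) y(2) \<open>x \<noteq> y\<close> by (intro proj_point_1_neq_1[OF 1]; simp)+
  ultimately show False
    using hyperoval_not_collinear[OF hyp, of ?u ?v ?w] by simp
qed

lemma hyperoval_slopes:
  assumes h: "h > 0" and hyp: "hyperoval (GF (2 ^ h)) (D (GF (2 ^ h)) (Polynomial.monom 1 k))"
  shows "bij_betw (\<lambda>x. ((x + 1) ^ k + 1) / x) (GF (2 ^ h) - {0}) (GF (2 ^ h) - {0})"
proof -
  let ?K = "GF (2 ^ h) - {0}" and ?g = "\<lambda>x. ((x + 1) ^ k + 1) / x"
  have inj: "inj_on ?g ?K"
    using hyperoval_slope_inj[OF h hyp] by (intro inj_onI) simp
  have "?g x \<in> ?K" if "x \<in> ?K" for x
  proof -
    have "?g x \<in> GF (2 ^ h)"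
      unfolding divide_inverse using that GF_subfield(2)[OF h]
      by (intro GF_subfield(3,5,6)[OF h] GF_power_closed[OF h]) auto
    then show ?thesis using hyperoval_slope_neq_0[OF h hyp] that by blast
  qed
  then have "?g ` ?K = ?K"
    using finite_GF[OF h] inj by (intro endo_inj_surj) auto
  with inj show ?thesis by (simp add: bij_betw_def)
qed

section \<open>Glynn's criterion\<close>

text \<open>Unlike \<open>m mod (q - 1)\<close>, this exponent also gives the same power of 0 as \<open>m\<close>.\<close>

definition reduced_exponent :: "nat \<Rightarrow> nat \<Rightarrow> nat" where
  "reduced_exponent q m = (if m = 0 then 0 else (m - 1) mod (q - 1) + 1)"

lemma power_reduced_exponent:
  assumes "x \<in> GF (2 ^ h)"
  shows "x ^ reduced_exponent (2 ^ h) m = x ^ m"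
proof (cases "m = 0 \<or> x = 0")
  case False
  let ?q = "2 ^ h - 1 :: nat"
  have "x ^ m = x ^ (?q * ((m - 1) div ?q) + ((m - 1) mod ?q + 1))"
    using False by simp
  also have "\<dots> = x ^ ((m - 1) mod ?q + 1)"
    using False assms GF_power_card_minus_one[of x h] by (simp only: power_add power_mult) simp
  finally show ?thesis using False by (simp add: reduced_exponent_def)
qed (auto simp: reduced_exponent_def)

lemma reduced_exponent_le:
  assumes "h > 0"
  shows "reduced_exponent (2 ^ h) m \<le> 2 ^ h - 1"
proof -
  have "2 ^ h - 1 > (0::nat)" using one_less_power[of "2::nat" h] assms by simp
  then have "(m - 1) mod (2 ^ h - 1) < 2 ^ h - 1" by (rule mod_less_divisor)
  then show ?thesis using assms by (auto simp: reduced_exponent_def)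
qed

lemma reduced_exponent_eq:
  assumes "0 < e" "e \<le> q - 1"
  shows "reduced_exponent q (e + (q - 1) * c) = e"
proof -
  have "(e + (q - 1) * c - 1) mod (q - 1) = (e - 1 + (q - 1) * c) mod (q - 1)"
    using assms by simp
  also have "\<dots> = e - 1" using assms by (subst mod_mult_self2) simp
  finally show ?thesis using assms by (simp add: reduced_exponent_def)
qed

lemma glynn_sum:
  assumes h: "h > 0" and hyp: "hyperoval (GF (2 ^ h)) (D (GF (2 ^ h)) (Polynomial.monom 1 k))"
    and d: "0 < d" "d < 2 ^ h - 1"
  shows "even (\<Sum>i\<le>d. (d choose i) * (reduced_exponent (2 ^ h) (k * i) choose d))"
proof -
  let ?K = "GF (2 ^ h) - {0}" and ?q = "2 ^ h - 1 :: nat"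
  let ?r = "\<lambda>i. reduced_exponent (2 ^ h) (k * i)"
  have "(\<Sum>y\<in>?K. y ^ d) = (0 :: bit alg_closure)"
    using d nat_dvd_not_less by (auto simp: sum_power_GF[OF h])
  then have "0 = (\<Sum>x\<in>?K. (((x + 1) ^ k + 1) / x) ^ d)"
    by (subst sum.reindex_bij_betw[OF hyperoval_slopes[OF h hyp]]) simp
  also have "\<dots> = (\<Sum>x\<in>?K. \<Sum>i\<le>d. of_nat (d choose i) * ((x + 1) ^ ?r i * x ^ (?q - d)))"
  proof (intro sum.cong refl)
    fix x assume x: "x \<in> ?K"
    then have x1: "x + 1 \<in> GF (2 ^ h)" using GF_subfield[OF h] by auto
    have "x ^ (?q - d) * x ^ d = 1"
      using x d GF_power_card_minus_one[of x h] by (simp flip: power_add)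
    then have "(((x + 1) ^ k + 1) / x) ^ d = ((x + 1) ^ k + 1) ^ d * x ^ (?q - d)"
      using x by (simp add: power_divide field_simps)
    then show "(((x + 1) ^ k + 1) / x) ^ d
      = (\<Sum>i\<le>d. of_nat (d choose i) * ((x + 1) ^ ?r i * x ^ (?q - d)))"
      \<comment> \<open>Here \<open>x + 1\<close> may be 0, so the reduced exponent has to preserve
        powers of 0 too.\<close>
      unfolding power_reduced_exponent[OF x1]
      by (simp add: binomial_ring[of "(x + 1) ^ k" 1 d] sum_distrib_right mult.assoc flip: power_mult)
  qed
  also have "\<dots> = (\<Sum>i\<le>d. of_nat (d choose i) * (\<Sum>x\<in>?K. (x + 1) ^ ?r i * x ^ (?q - d)))"
    by (subst sum.swap) (simp add: sum_distrib_left)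
  also have "\<dots> = of_nat (\<Sum>i\<le>d. (d choose i) * (?r i choose d))"
    by (simp only: sum_GF_binomial[OF h d reduced_exponent_le[OF h]] of_nat_sum of_nat_mult)
  finally show ?thesis
    by (simp only: of_nat_char2) (auto split: if_splits)
qed

text \<open>In \<open>glynn_sum\<close> the terms with \<open>0 < i < d\<close> are even by
  induction, because \<open>(?r i choose d) * (d choose i)\<close> is a multiple of
  \<open>?r i choose i\<close>. The term \<open>i = 0\<close> vanishes, which leaves
  \<open>i = d\<close>.\<close>

lemma glynn_criterion:
  assumes h: "h > 0" and hyp: "hyperoval (GF (2 ^ h)) (D (GF (2 ^ h)) (Polynomial.monom 1 k))"
  shows "0 < d \<Longrightarrow> d < 2 ^ h - 1 \<Longrightarrow> even (reduced_exponent (2 ^ h) (k * d) choose d)"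
proof (induction d rule: less_induct)
  case (less d)
  let ?r = "\<lambda>i. reduced_exponent (2 ^ h) (k * i)"
  have "even ((d choose i) * (?r i choose d))" if i: "i < d" for i
  proof (cases "i = 0")
    case True
    then show ?thesis using less.prems by (simp add: reduced_exponent_def binomial_eq_0)
  next
    case False
    then have ev: "even (?r i choose i)" using less that by simp
    show ?thesis
    proof (cases "d \<le> ?r i")
      case True
      then have "(?r i choose d) * (d choose i) = (?r i choose i) * (?r i - i choose (d - i))"
        using that by (intro choose_mult) auto
      with ev show ?thesis by (metis dvd_mult2 mult.commute)
    qed (simp add: binomial_eq_0)
  qed
  then have "even (\<Sum>i<d. (d choose i) * (?r i choose d))" by (intro dvd_sum) auto
  moreover have "even ((\<Sum>i<d. (d choose i) * (?r i choose d)) + (?r d choose d))"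
    using glynn_sum[OF h hyp less.prems]
    by (simp flip: lessThan_Suc_atMost)
  ultimately show ?case by simp
qed

text \<open>Equal initial and final carries 1 give \<open>2 * n * d = e + (2 ^ h - 1)\<close>, so
  \<open>e\<close> is the reduced exponent and violates Glynn's criterion.\<close>

lemma closed_carry_walk_not_hyperoval:
  assumes h: "h > 0" and n: "n > 1" and walk: "(1, 1) \<in> carry_step n ^^ h"
  shows "\<not> hyperoval (GF (2 ^ h)) (D (GF (2 ^ h)) (Polynomial.monom 1 (2 * n)))"
proof
  assume hyp: "hyperoval (GF (2 ^ h)) (D (GF (2 ^ h)) (Polynomial.monom 1 (2 * n)))"
  obtain d e where de: "d < 2 ^ h" "e < 2 ^ h" "odd (e choose d)" "1 + 2 * n * d = 2 ^ h * 1 + e"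
    using carry_walk_digits[OF walk] by blast
  have q: "2 ^ h > (1::nat)" using h by (intro one_less_power) auto
  have d0: "d > 0" using de(4) q by (cases d) auto
  have "d \<le> e" using de(3) binomial_eq_0[of e d] by (cases "d \<le> e") auto
  \<comment> \<open>Otherwise \<open>e = d\<close>, which forces \<open>n = 1\<close>.\<close>
  have "d \<noteq> 2 ^ h - 1"
  proof
    assume d: "d = 2 ^ h - 1"
    then have "e = d" using \<open>d \<le> e\<close> de(2) by simp
    moreover have "2 ^ h = Suc d" using d q by simp
    ultimately have "2 * n * d = 2 * d" using de(4) by linarith
    then show False using d0 n by simp
  qed
  then have "d < 2 ^ h - 1" using de(1) by simp
  moreover have "2 * n * d = e + (2 ^ h - 1) * 1" using de(4) q by simp
  then have "reduced_exponent (2 ^ h) (2 * n * d) = e"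
    using reduced_exponent_eq[of e "2 ^ h" 1] \<open>d \<le> e\<close> d0 de(2) by simp
  ultimately show False using glynn_criterion[OF h hyp d0] de(3) by simp
qed

section \<open>Numerical semigroups and closed walks in the carry graph\<close>

text \<open>The least positive difference of two elements divides every element, hence is 1. Two
  consecutive elements \<open>b\<close> and \<open>b + 1\<close> then generate everything from
  \<open>b * b\<close> on.\<close>

lemma eventually_in_additive_set:
  fixes S :: "nat set"
  assumes add: "\<And>a b. a \<in> S \<Longrightarrow> b \<in> S \<Longrightarrow> a + b \<in> S" and "0 \<in> S" "l \<in> S" "l > 0"
    and gcd1: "\<And>p. (\<And>s. s \<in> S \<Longrightarrow> p dvd s) \<Longrightarrow> p = 1"
  shows "\<exists>N. \<forall>m\<ge>N. m \<in> S"
proof -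
  have mult: "m * a \<in> S" if "a \<in> S" for a m
    using that add \<open>0 \<in> S\<close> by (induction m) auto
  define P where "P = (\<lambda>\<delta>. \<delta> > 0 \<and> (\<exists>b\<in>S. b + \<delta> \<in> S))"
  define \<delta> where "\<delta> = (LEAST \<delta>. P \<delta>)"
  have "P l" using assms(2-4) by (auto simp: P_def intro!: bexI[of _ 0])
  then have \<delta>: "P \<delta>" unfolding \<delta>_def by (rule LeastI)
  then obtain b where b: "\<delta> > 0" "b \<in> S" "b + \<delta> \<in> S" by (auto simp: P_def)
  have "\<delta> dvd s" if "s \<in> S" for s
  proof (rule ccontr)
    assume "\<not> \<delta> dvd s"
    then have r: "s mod \<delta> > 0" by (simp add: mod_greater_zero_iff_not_dvd)
    \<comment> \<open>Exhibits the remainder as a smaller difference of two elements of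
      \<open>S\<close>.\<close>
    have "(s div \<delta>) * (b + \<delta>) + s mod \<delta> = s + (s div \<delta>) * b"
      by (simp add: algebra_simps)
    then have "P (s mod \<delta>)" using r mult b add that unfolding P_def by metis
    then have "\<delta> \<le> s mod \<delta>" unfolding \<delta>_def by (rule Least_le)
    then show False using b(1) by (meson mod_less_divisor not_le)
  qed
  then have "\<delta> = 1" by (rule gcd1)
  have "m \<in> S" if m: "m \<ge> b * b" for m
  proof (cases "b = 0")
    case True
    with b \<open>\<delta> = 1\<close> mult[of 1 m] show ?thesis by simp
  next
    case False
    define r where "r = m mod b"
    have "r \<le> m div b"
      using m False unfolding r_def by (metis div_le_mono le_trans less_imp_le mod_less_divisor
        nonzero_mult_div_cancel_right not_gr_zero)
    then obtain t where t: "m div b = r + t" using le_Suc_ex by blast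
    have "m = (m div b) * b + r" by (simp add: r_def)
    also have "\<dots> = t * b + r * (b + 1)" unfolding t by (simp add: algebra_simps)
    finally show ?thesis using b \<open>\<delta> = 1\<close> mult add by metis
  qed
  then show ?thesis by blast
qed

lemma carry_walk_div: "(c, c div 2 ^ j) \<in> carry_step n ^^ j"
proof (induction j)
  case (Suc j)
  have "(c div 2 ^ j, c div 2 ^ Suc j) \<in> carry_step n"
    by (simp add: carry_step_def div_mult2_eq power_Suc2 del: power_Suc)
  with Suc show ?case by (rule relpow_Suc_I)
qed simp

lemma relpow_trans: "(x, y) \<in> R ^^ i \<Longrightarrow> (y, z) \<in> R ^^ j \<Longrightarrow> (x, z) \<in> R ^^ (i + j)"
  by (auto simp: relpow_add)

lemma carry_walk_log:
  assumes "(1, c) \<in> carry_step n ^^ t" "2 ^ l \<le> c" "c < 2 ^ Suc l"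
  shows "(1, 1) \<in> carry_step n ^^ (t + l)"
proof -
  have "c div 2 ^ l = 1" using assms(2,3) by (intro div_nat_eqI) auto
  then show ?thesis using relpow_trans[OF assms(1) carry_walk_div[of c l n]] by simp
qed

text \<open>Halving leads from \<open>c\<close> to 1 in \<open>\<lfloor>log\<^sub>2 c\<rfloor>\<close> steps, so \<open>p\<close> divides \<open>t + \<lfloor>log\<^sub>2 c\<rfloor>\<close>
  whenever \<open>c\<close> is reached from 1 in \<open>t\<close> steps. Comparing the two successors of the odd
  vertices \<open>w div 2 ^ j\<close> then restricts the binary digits of every vertex \<open>w\<close> that is reached and is
  as long as \<open>n\<close>. If \<open>2 ^ a\<close> is the second highest digit of \<open>n\<close>, a vertex with digit \<open>a + 1\<close>
  is reached as well, so that \<open>p\<close> divides both \<open>a + 1\<close> and \<open>a + 2\<close>.\<close>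

lemma period_of_carry_walks:
  assumes n: "n > 1" "n \<noteq> 3" "\<And>i. n \<noteq> 2 ^ i"
    and p: "\<And>t. (1, 1) \<in> carry_step n ^^ t \<Longrightarrow> p dvd t"
  shows "p = 1"
proof (rule ccontr)
  assume "p \<noteq> 1"
  then have con: False if "p dvd a" "p dvd Suc a" for a
    using that dvd_diff_nat[OF that(2,1)] by simp
  obtain l where l: "2 ^ l \<le> n" "n < 2 ^ Suc l"
    using ex_power_ivl1[of 2 n] n(1) by auto
  with n(1) obtain i where i: "l = Suc i" by (cases l) auto
  have "(1, n) \<in> carry_step n" by (simp add: carry_step_def)
  then have walk_n: "(1, n) \<in> carry_step n ^^ 1" by simp
  have p_l: "p dvd Suc l" using carry_walk_log[OF walk_n l] p by fastforce
  define W where "W = {w. (\<exists>t. (1, w) \<in> carry_step n ^^ t) \<and> 2 ^ l \<le> w \<and> w < 2 ^ Suc l}"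
  have nW: "n \<in> W" using walk_n l unfolding W_def by blast
  \<comment> \<open>The two cases are whether adding \<open>n\<close> keeps the length or adds one
    digit.\<close>
  have branch: "if n + w div 2 ^ Suc j < 2 ^ Suc l
      then n + w div 2 ^ Suc j \<in> W \<and> p dvd Suc j else p dvd Suc (Suc j)"
    if w: "w \<in> W" "odd (w div 2 ^ j)" for w j
  proof -
    let ?w' = "n + w div 2 ^ Suc j"
    obtain t where t: "(1, w) \<in> carry_step n ^^ t" "2 ^ l \<le> w" "w < 2 ^ Suc l"
      using w(1) by (auto simp: W_def)
    have "(w div 2 ^ j, ?w') \<in> carry_step n"
      using w(2) by (simp add: carry_step_def div_mult2_eq power_Suc2 del: power_Suc)
    with relpow_trans[OF t(1) carry_walk_div[of w j n]]
    have walk: "(1, ?w') \<in> carry_step n ^^ Suc (t + j)" by (rule relpow_Suc_I)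
    have pt: "p dvd t + l" by (intro p carry_walk_log[OF t])
    have lo: "2 ^ l \<le> ?w'" using l(1) by simp
    show ?thesis
    proof (cases "?w' < 2 ^ Suc l")
      case True
      have "p dvd Suc (t + j) + l" by (intro p carry_walk_log[OF walk lo True])
      also have "Suc (t + j) + l = (t + l) + Suc j" by simp
      finally have "p dvd Suc j" using pt by (simp only: dvd_add_right_iff)
      with True lo walk show ?thesis by (auto simp: W_def simp del: power_Suc relpow.simps)
    next
      case False
      have "w div 2 ^ Suc j \<le> w" by (rule div_le_dividend)
      then have "?w' < 2 ^ Suc l + 2 ^ Suc l" using l(2) t(3) by linarith
      then have "?w' < 2 ^ Suc (Suc l)" by simp
      with False have "p dvd Suc (t + j) + Suc l" by (intro p carry_walk_log[OF walk]) auto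
      also have "Suc (t + j) + Suc l = (t + l) + Suc (Suc j)" by simp
      finally have "p dvd Suc (Suc j)" using pt by (simp only: dvd_add_right_iff)
      with False show ?thesis by simp
    qed
  qed
  \<comment> \<open>If \<open>n\<close> had only digits 1, the branch at \<open>i - 1\<close> would
    overflow and give \<open>p dvd l\<close>, against \<open>p_l\<close>. That position exists as
    \<open>n \<noteq> 3\<close>.\<close>
  have n1: "n + 1 < 2 ^ Suc l"
  proof (rule ccontr)
    assume "\<not> ?thesis"
    then have n_eq: "n + 1 = 4 * 2 ^ i" using l(2) i by simp
    with n(2) obtain i' where i': "i = Suc i'" by (cases i) auto
    have "n div 2 ^ i' = 7" "n div 2 ^ Suc i' = 3"
      using n_eq i' by (auto intro!: div_nat_eqI)
    then show False
      using branch[OF nW, of i'] p_l con[of l] n_eq i i' by simp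
  qed
  \<comment> \<open>The second digit of \<open>w\<close> must be 0: otherwise the branch at
    \<open>i\<close> leads to \<open>n + 1\<close> and gives \<open>p dvd l\<close>.\<close>
  have W_less: "w < 3 * 2 ^ i" if w: "w \<in> W" for w
  proof (rule ccontr)
    assume "\<not> ?thesis"
    then have "w div 2 ^ i = 3" "w div 2 ^ Suc i = 1"
      using w i by (auto simp: W_def intro!: div_nat_eqI)
    then show False
      using branch[OF w, of i] p_l con[of l] n1 i by simp
  qed
  have branch': "n + w div 2 ^ Suc j \<in> W \<and> p dvd Suc j"
    if w: "w \<in> W" "odd (w div 2 ^ j)" and j: "j > 0" for w j
  proof -
    have "(2::nat) ^ 2 \<le> 2 ^ Suc j" using j by (intro power_increasing) auto
    then have "w div 2 ^ Suc j \<le> w div 4" by (intro div_le_mono2) auto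
    then have "n + w div 2 ^ Suc j < 2 ^ Suc l"
      using W_less[OF w(1)] W_less[OF nW] i by simp
    then show ?thesis using branch[OF w] by metis
  qed
  define m where "m = n - 2 ^ l"
  have nm: "n = 2 ^ l + m" using l(1) by (simp add: m_def)
  have "m > 0" using nm n(3)[of l] by (cases m) auto
  then obtain a where a: "2 ^ a \<le> m" "m < 2 ^ Suc a"
    using ex_power_ivl1[of 2 m] by auto
  have "m < 2 ^ i" using W_less[OF nW] nm i by simp
  with a(1) have "(2::nat) ^ a < 2 ^ i" by (rule le_less_trans)
  then have "a < i" by (metis nat_power_less_imp_less zero_less_numeral)
  show False
  proof (cases "a = 0")
    \<comment> \<open>Here \<open>n\<close> is odd, and the branch at position 0 gives
      \<open>p dvd 1\<close>.\<close>
    case True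
    with a nm i have n_eq: "n = 2 * 2 ^ i + 1" by simp
    have "(2::nat) ^ 1 \<le> 2 ^ i" using \<open>a < i\<close> by (intro power_increasing) auto
    then have "n + n div 2 < 4 * 2 ^ i" using n_eq by simp
    then show False using branch[OF nW, of 0] n_eq i \<open>p \<noteq> 1\<close> by simp
  next
    case False
    define e where "e = l - Suc a"
    have e: "e > 0" "l = a + Suc e" using \<open>a < i\<close> i by (auto simp: e_def)
    have nm': "n = 2 * (2 ^ a * 2 ^ e) + m" using nm e(2) by (simp add: power_add)
    have "n div 2 ^ a = 2 * 2 ^ e + 1" "n div 2 ^ Suc a = 2 ^ e"
      using nm' a by (auto intro!: div_nat_eqI simp: algebra_simps)
    then have V: "n + 2 ^ e \<in> W" "p dvd Suc a"
      using branch'[OF nW, of a] False by auto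
    \<comment> \<open>Needs a vertex with digit 1 at position \<open>e\<close> that agrees with
      \<open>n\<close> above it: \<open>n\<close> itself, or else \<open>n + 2 ^ e\<close>.\<close>
    have U: "n + n div 2 ^ Suc e \<in> W"
    proof (cases "odd (n div 2 ^ e)")
      case True
      then show ?thesis using branch'[OF nW] e(1) by blast
    next
      case False
      have V_div: "(n + 2 ^ e) div 2 ^ e = Suc (n div 2 ^ e)" by simp
      have "(n + 2 ^ e) div 2 ^ Suc e = Suc (n div 2 ^ e) div 2"
        unfolding power_Suc2 div_mult2_eq V_div ..
      also have "\<dots> = n div 2 ^ e div 2" using False by simp
      also have "\<dots> = n div 2 ^ Suc e" unfolding power_Suc2 div_mult2_eq ..
      finally show ?thesis using branch'[OF V(1), of e] V_div False e(1) by simp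
    qed
    have "n = m + 2 ^ a * 2 ^ Suc e" using nm' by simp
    then have n_div: "n div 2 ^ Suc e = 2 ^ a + m div 2 ^ Suc e" by simp
    have "(2::nat) ^ 1 \<le> 2 ^ Suc e" by (intro power_increasing) auto
    then have "m div 2 ^ Suc e \<le> m div 2" by (intro div_le_mono2) auto
    \<comment> \<open>The added \<open>2 ^ a\<close> meets the digit \<open>2 ^ a\<close> of
      \<open>n\<close> and carries into position \<open>a + 1\<close>.\<close>
    then have "(n + n div 2 ^ Suc e) div 2 ^ Suc a = 2 ^ e + 1"
      unfolding n_div using nm' a by (intro div_nat_eqI) (auto simp: algebra_simps)
    then have "odd ((n + n div 2 ^ Suc e) div 2 ^ Suc a)" using e(1) by simp
    then have "p dvd Suc (Suc a)" using branch'[OF U] by blast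
    with V(2) show False by (rule con)
  qed
qed

lemma eventually_closed_carry_walk:
  assumes n: "n > 1" "n \<noteq> 3" "\<And>i. n \<noteq> 2 ^ i"
  shows "\<exists>N. \<forall>h\<ge>N. (1, 1) \<in> carry_step n ^^ h"
proof -
  define S where "S = {t. (1, 1) \<in> carry_step n ^^ t}"
  obtain l where l: "2 ^ l \<le> n" "n < 2 ^ Suc l"
    using ex_power_ivl1[of 2 n] n(1) by auto
  have "(1, n) \<in> carry_step n ^^ 1" by (simp add: carry_step_def)
  from carry_walk_log[OF this l] have "1 + l \<in> S" by (simp only: S_def mem_Collect_eq)
  then have "\<exists>N. \<forall>m\<ge>N. m \<in> S"
  proof (rule eventually_in_additive_set[rotated 2])
    show "a + b \<in> S" if "a \<in> S" "b \<in> S" for a b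
      using that relpow_trans by (auto simp: S_def)
    show "p = 1" if "\<And>s. s \<in> S \<Longrightarrow> p dvd s" for p
      using period_of_carry_walks[OF n, of p] that by (simp add: S_def)
  qed (auto simp: S_def)
  then show ?thesis by (simp add: S_def)
qed

lemma finite_hyperoval_monom:
  assumes n: "n > 1" "n \<noteq> 3" "\<And>i. n \<noteq> 2 ^ i"
  shows "finite {q. (\<exists>h>0. q = 2 ^ h) \<and>
    hyperoval (GF q) (D (GF q) (Polynomial.monom 1 (2 * n)))}"
proof -
  obtain N where N: "\<And>h. h \<ge> N \<Longrightarrow> (1, 1) \<in> carry_step n ^^ h"
    using eventually_closed_carry_walk[OF n] by blast
  have "{q. (\<exists>h>0. q = 2 ^ h) \<and> hyperoval (GF q) (D (GF q) (Polynomial.monom 1 (2 * n)))}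
      \<subseteq> (\<lambda>h. 2 ^ h) ` {..<N}"
  proof clarify
    fix h :: nat
    assume h: "h > 0" "hyperoval (GF (2 ^ h)) (D (GF (2 ^ h)) (Polynomial.monom 1 (2 * n)))"
    then have "h < N"
      using closed_carry_walk_not_hyperoval[OF h(1) n(1)] N[of h] not_le by blast
    then show "2 ^ h \<in> (\<lambda>h. 2 ^ h) ` {..<N}" by blast
  qed
  then show ?thesis by (rule finite_subset) simp
qed

theorem theorem1p1:
  fixes k :: nat
  assumes "k > 0" and "even k" and "k \<noteq> 6" and "\<forall>i. k \<noteq> 2 ^ i"
  shows "finite {q. (\<exists>h>0. q = 2 ^ h) \<and> hyperoval (GF q) (D (GF q) (Polynomial.monom 1 k))}"
proof -
  obtain n where k: "k = 2 * n" using assms(2) by blast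
  have n: "n \<noteq> 2 ^ i" for i using assms(4)[rule_format, of "Suc i"] k by simp
  have "n > 1" using n[of 0] k assms(1) by (cases "n = 0") auto
  moreover have "n \<noteq> 3" using assms(3) k by simp
  ultimately show ?thesis unfolding k using n by (rule finite_hyperoval_monom)
qed

end
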